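(* Let $k\ge 1$ be an integer and $\lambda>0$. Let $\{D_f(t)\}_{t\ge 0}$ be a Lévy subordinator with Bernstein function $f$ such that $\mathbb{E}[D_f^{\rho}(t)]<\infty$ for all $\rho>0$, and let $Q_f^{(1)}(t)=N^{(k)}(D_f(t))$, $t\ge 0$, where $\{N^{(k)}(t)\}_{t\ge 0}$ is the Poisson process of order $k$ with parameter $\lambda$, independent of $\{D_f(t)\}_{t\ge 0}$. Then the probability mass function of $Q_f^{(1)}(t)$ is $$\mathbb{P}[Q_f^{(1)}(t)=n]=\sum_{\mathbf{x}\in\Omega(k,n)}\frac{\lambda^{\zeta_k}}{\Pi_k!}\,\mathbb{E}\left[e^{-k\lambda D_f(t)}D_f^{\zeta_k}(t)\right],\qquad n=0,1,2,\ldots.$$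
   Context: Notation: for $\mathbf{x}=(x_1,\ldots,x_k)$ with non-negative integer entries, $\zeta_k=x_1+x_2+\cdots+x_k$, $\Pi_k!=x_1!x_2!\cdots x_k!$, and $\Omega(k,n)=\{\mathbf{x}=(x_1,\ldots,x_k): x_1+2x_2+\cdots+kx_k=n\}$ (non-negative integer vectors). Poisson process of order $k$ (PPoK) with parameter $\lambda$: $N^{(k)}(t)=\sum_{i=0}^{N(t,k\lambda)}X_i$, where $\{N(t,k\lambda)\}_{t\ge0}$ is a Poisson process of rate $k\lambda$, $X_0\equiv 0$, and $\{X_i\}_{i\ge 1}$ are IID uniform on $\{1,2,\ldots,k\}$, independent of the Poisson process. Lévy subordinator: a non-decreasing Lévy process $\{D_f(t)\}_{t\ge 0}$ with $\mathbb{E}[e^{-sD_f(t)}]=e^{-tf(s)}$, where $f(s)=bs+\int_0^\infty(1-e^{-sx})\,\nu(dx)$, $s>0$, is its Bernstein function, $b\ge 0$, and $\nu$ is a non-negative Lévy measure on the positive half-line with $\int_0^\infty (x\wedge 1)\,\nu(dx)<\infty$ and total mass $\infty$ (so that paths are a.s. strictly increasing). $D_f^{\rho}(t)$ denotes $(D_f(t))^{\rho}$. *)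

theory Defs
  imports "HOL-Probability.Probability"
begin

text \<open>
  Stochastic processes are families \<open>X t \<omega>\<close> with time \<open>t :: real\<close>; only the times \<open>t \<ge> 0\<close> are
  ever constrained, the values at negative times are junk.
\<close>

definition independent_increments :: "'w measure \<Rightarrow> (real \<Rightarrow> 'w \<Rightarrow> real) \<Rightarrow> bool" where
  "independent_increments M X \<longleftrightarrow>
    (\<forall>(m::nat) (\<tau>::nat \<Rightarrow> real).
       0 \<le> \<tau> 0 \<and> (\<forall>i<m. \<tau> i \<le> \<tau> (Suc i)) \<longrightarrow>
       prob_space.indep_vars M (\<lambda>_. borel) (\<lambda>i \<omega>. X (\<tau> (Suc i)) \<omega> - X (\<tau> i) \<omega>) {..<m})"

definition generated_events ::
  "'w measure \<Rightarrow> 'a measure \<Rightarrow> 'i set \<Rightarrow> ('i \<Rightarrow> 'w \<Rightarrow> 'a) \<Rightarrow> 'w set set" where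
  "generated_events M S I X =
    sigma_sets (space M) (\<Union>i\<in>I. {X i -` A \<inter> space M | A. A \<in> sets S})"

text \<open>
  Independence of two processes means independence of the \<open>\<sigma>\<close>-algebras generated by the whole
  families. The library's \<open>indep_var\<close> on product spaces would say the same, but it
  forces both families to have the same type.
\<close>

definition independent_processes ::
  "'w measure \<Rightarrow> 'a measure \<Rightarrow> 'i set \<Rightarrow> ('i \<Rightarrow> 'w \<Rightarrow> 'a) \<Rightarrow>
   'b measure \<Rightarrow> 'j set \<Rightarrow> ('j \<Rightarrow> 'w \<Rightarrow> 'b) \<Rightarrow> bool" where
  "independent_processes M S I X T J Y \<longleftrightarrow>
    prob_space.indep_set M (generated_events M S I X) (generated_events M T J Y)"

text \<open>
  The paths of a Poisson process are counting paths for every \<open>\<omega>\<close>, so that evaluating the process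
  at a random time again gives a random variable, without completing \<open>M\<close>.
  The natural-number subtraction below does not truncate, because the paths are non-decreasing.
\<close>

definition poisson_process :: "'w measure \<Rightarrow> real \<Rightarrow> (real \<Rightarrow> 'w \<Rightarrow> nat) \<Rightarrow> bool" where
  "poisson_process M r N \<longleftrightarrow>
    (\<forall>t\<ge>0. N t \<in> measurable M (count_space UNIV)) \<and>
    (\<forall>\<omega>\<in>space M. N 0 \<omega> = 0 \<and> mono_on {0..} (\<lambda>t. N t \<omega>) \<and>
       (\<forall>t\<ge>0. continuous (at_right t) (\<lambda>s. N s \<omega>))) \<and>
    independent_increments M (\<lambda>t \<omega>. real (N t \<omega>)) \<and>
    (\<forall>s t. 0 \<le> s \<and> s < t \<longrightarrow>
       distr M (count_space UNIV) (\<lambda>\<omega>. N t \<omega> - N s \<omega>) = measure_pmf (poisson_pmf (r * (t - s))))"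

definition poisson_process_of_order ::
  "'w measure \<Rightarrow> nat \<Rightarrow> real \<Rightarrow> (real \<Rightarrow> 'w \<Rightarrow> nat) \<Rightarrow> bool" where
  "poisson_process_of_order M k lam Nk \<longleftrightarrow>
    (\<exists>(N :: real \<Rightarrow> 'w \<Rightarrow> nat) (X :: nat \<Rightarrow> 'w \<Rightarrow> nat).
       poisson_process M (real k * lam) N \<and>
       (\<forall>\<omega>\<in>space M. X 0 \<omega> = 0) \<and>
       prob_space.indep_vars M (\<lambda>_. count_space UNIV) X {1..} \<and>
       (\<forall>i\<ge>1. distr M (count_space UNIV) (X i) = measure_pmf (pmf_of_set {1..k})) \<and>
       independent_processes M (count_space UNIV) {1..} X (count_space UNIV) {0..} N \<and>
       (\<forall>t\<ge>0. \<forall>\<omega>\<in>space M. Nk t \<omega> = (\<Sum>i=0..N t \<omega>. X i \<omega>)))"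

definition levy_process :: "'w measure \<Rightarrow> (real \<Rightarrow> 'w \<Rightarrow> real) \<Rightarrow> bool" where
  "levy_process M X \<longleftrightarrow>
    (\<forall>t\<ge>0. X t \<in> borel_measurable M) \<and>
    (AE \<omega> in M. X 0 \<omega> = 0) \<and>
    independent_increments M X \<and>
    (\<forall>s t. 0 \<le> s \<and> s \<le> t \<longrightarrow>
       distr M borel (\<lambda>\<omega>. X t \<omega> - X s \<omega>) = distr M borel (X (t - s))) \<and>
    (\<forall>t\<ge>0. \<forall>\<epsilon>>0.
       ((\<lambda>s. measure M {\<omega> \<in> space M. \<bar>X s \<omega> - X t \<omega>\<bar> > \<epsilon>}) \<longlongrightarrow> 0) (at t within {0..})) \<and>
    (AE \<omega> in M. (\<forall>t\<ge>0. continuous (at_right t) (\<lambda>s. X s \<omega>)) \<and>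
       (\<forall>t>0. \<exists>l. ((\<lambda>s. X s \<omega>) \<longlongrightarrow> l) (at_left t)))"

text \<open>
  A Levy measure on the positive half-line is a Borel measure on the reals that does not charge
  the non-positive numbers.
\<close>

definition bernstein_function :: "(real \<Rightarrow> real) \<Rightarrow> bool" where
  "bernstein_function f \<longleftrightarrow>
    (\<exists>(b::real) (\<nu>::real measure).
       0 \<le> b \<and>
       sets \<nu> = sets borel \<and> emeasure \<nu> {..0} = 0 \<and>
       (\<integral>\<^sup>+x\<in>{0<..}. ennreal (min x 1) \<partial>\<nu>) < \<infinity> \<and>
       emeasure \<nu> {0<..} = \<infinity> \<and>
       (\<forall>s>0. f s = b * s + (LINT x:{0<..}|\<nu>. 1 - exp (- s * x))))"

text \<open>
  The values are required to be non-negative for every \<open>\<omega>\<close>, as they serve as times of another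
  process; all other path properties hold almost surely.
\<close>

definition levy_subordinator ::
  "'w measure \<Rightarrow> (real \<Rightarrow> real) \<Rightarrow> (real \<Rightarrow> 'w \<Rightarrow> real) \<Rightarrow> bool" where
  "levy_subordinator M f D \<longleftrightarrow>
    levy_process M D \<and>
    (\<forall>t\<ge>0. \<forall>\<omega>\<in>space M. 0 \<le> D t \<omega>) \<and>
    (AE \<omega> in M. mono_on {0..} (\<lambda>t. D t \<omega>)) \<and>
    bernstein_function f \<and>
    (\<forall>t\<ge>0. \<forall>s>0. (LINT \<omega>|M. exp (- s * D t \<omega>)) = exp (- t * f s))"

text \<open>
  Vectors \<open>(x\<^sub>1, \<dots>, x\<^sub>k)\<close> are functions on \<open>{1..k}\<close>, extensional so that each vector is
  counted once.
\<close>

definition Omega :: "nat \<Rightarrow> nat \<Rightarrow> (nat \<Rightarrow> nat) set" where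
  "Omega k n = {x \<in> {1..k} \<rightarrow>\<^sub>E UNIV. (\<Sum>j=1..k. j * x j) = n}"

definition zeta :: "nat \<Rightarrow> (nat \<Rightarrow> nat) \<Rightarrow> nat" where
  "zeta k x = (\<Sum>j=1..k. x j)"

definition Pi_fact :: "nat \<Rightarrow> (nat \<Rightarrow> nat) \<Rightarrow> real" where
  "Pi_fact k x = (\<Prod>j=1..k. fact (x j))"

lemma finite_Omega: "finite (Omega k n)"
proof (rule finite_subset)
  show "Omega k n \<subseteq> {1..k} \<rightarrow>\<^sub>E {..n}"
  proof
    fix x assume x: "x \<in> Omega k n"
    have "x j \<le> n" if j: "j \<in> {1..k}" for j
    proof -
      have "x j \<le> j * x j" using j by simp
      also have "\<dots> \<le> (\<Sum>j=1..k. j * x j)"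
        using j by (intro member_le_sum) auto
      finally show ?thesis using x by (simp add: Omega_def)
    qed
    then show "x \<in> {1..k} \<rightarrow>\<^sub>E {..n}"
      using x by (auto simp: Omega_def PiE_iff)
  qed
qed (auto intro: finite_PiE)

end

theory Submission
  imports Defs
begin

text \<open>
  At a fixed time \<open>s\<close> the mass function \<open>g(s)\<close> of \<open>N\<^sup>(\<^sup>k\<^sup>)(s)\<close> at \<open>n\<close> follows by conditioning on the
  number \<open>m\<close> of Poisson events: among the \<open>k\<^sup>m\<close> equally likely values of \<open>(X\<^sub>1, \<dots>, X\<^sub>m)\<close>, those with
  sum \<open>n\<close> and with \<open>x\<^sub>j\<close> entries equal to \<open>j\<close> number \<open>m! / \<Pi>\<^sub>k!\<close>, and the factors \<open>m!\<close> and \<open>k\<^sup>m\<close> cancel.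
  Since \<open>g\<close> is continuous and the paths of \<open>N\<^sup>(\<^sup>k\<^sup>)\<close> are right continuous, the independent random time
  may be inserted for \<open>s\<close>; integrating term by term uses the finite moments.
\<close>

section \<open>Vectors with prescribed weight and number of entries\<close>

abbreviation Omega_zeta :: "nat \<Rightarrow> nat \<Rightarrow> nat \<Rightarrow> (nat \<Rightarrow> nat) set" where
  "Omega_zeta k n m \<equiv> {x \<in> Omega k n. zeta k x = m}"

text \<open>Raising the entry at \<open>j\<close> corresponds to adding one summand of size
  \<open>j\<close>: the weight grows by \<open>j\<close> and the count by one. The condition
  \<open>x j > 0\<close> makes lowering that entry the inverse map, and \<open>j \<le> n\<close>
  keeps \<open>n - j\<close> from truncating.\<close>

lemma bij_betw_Omega_zeta_increment:
  assumes "j \<in> {1..k}" and "j \<le> n"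
  shows "bij_betw (\<lambda>y. y(j := Suc (y j))) (Omega_zeta k (n - j) m)
           {x \<in> Omega_zeta k n (Suc m). x j > 0}"
proof -
  \<comment> \<open>Both identities put the old entry on the left instead of subtracting it on the
    right, so they hold on \<open>nat\<close> without side conditions, for raising and lowering
    alike.\<close>
  have weight: "(\<Sum>i=1..k. i * (x(j := v)) i) + j * x j = (\<Sum>i=1..k. i * x i) + j * v"
    and count: "zeta k (x(j := v)) + x j = zeta k x + v" for x :: "nat \<Rightarrow> nat" and v
    using assms(1) by (simp_all add: zeta_def sum.remove)
  show ?thesis
  proof (rule bij_betw_byWitness[where f' = "\<lambda>x. x(j := x j - 1)"])
    show "(\<lambda>y. y(j := Suc (y j))) ` Omega_zeta k (n - j) m \<subseteq> {x \<in> Omega_zeta k n (Suc m). x j > 0}"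
    proof (rule image_subsetI)
      fix y assume y: "y \<in> Omega_zeta k (n - j) m"
      show "y(j := Suc (y j)) \<in> {x \<in> Omega_zeta k n (Suc m). x j > 0}"
        using y assms weight[of y "Suc (y j)"] count[of y "Suc (y j)"]
        by (auto simp: Omega_def PiE_iff extensional_def)
    qed
    show "(\<lambda>x. x(j := x j - 1)) ` {x \<in> Omega_zeta k n (Suc m). x j > 0} \<subseteq> Omega_zeta k (n - j) m"
    proof (rule image_subsetI)
      fix x assume x: "x \<in> {x \<in> Omega_zeta k n (Suc m). x j > 0}"
      then obtain v where v: "x j = Suc v" by (auto simp: gr0_conv_Suc)
      show "x(j := x j - 1) \<in> Omega_zeta k (n - j) m"
        using x v assms weight[of x v] count[of x v]
        by (auto simp: Omega_def PiE_iff extensional_def)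
    qed
  qed auto
qed

lemma Pi_fact_increment:
  assumes "j \<in> {1..k}"
  shows "Pi_fact k (y(j := Suc (y j))) = real (Suc (y j)) * Pi_fact k y"
  using assms by (simp add: Pi_fact_def prod.remove algebra_simps)

text \<open>
  Write \<open>m + 1 = x\<^sub>1 + \<dots> + x\<^sub>k\<close> and cancel each \<open>x\<^sub>j\<close> against \<open>x\<^sub>j!\<close>.
\<close>

lemma sum_inverse_Pi_fact_Suc:
  "real (Suc m) * (\<Sum>x\<in>Omega_zeta k n (Suc m). 1 / Pi_fact k x) =
    (\<Sum>j | j \<in> {1..k} \<and> j \<le> n. \<Sum>y\<in>Omega_zeta k (n - j) m. 1 / Pi_fact k y)"
proof -
  have fin: "finite (Omega_zeta k n m)" for n m
    using finite_Omega by simp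
  have "real (Suc m) * (\<Sum>x\<in>Omega_zeta k n (Suc m). 1 / Pi_fact k x) =
      (\<Sum>x\<in>Omega_zeta k n (Suc m). \<Sum>j=1..k. real (x j) / Pi_fact k x)"
    by (auto simp: sum_distrib_left zeta_def simp flip: sum_divide_distrib of_nat_sum
        intro!: sum.cong)
  also have "\<dots> = (\<Sum>j=1..k. \<Sum>x\<in>Omega_zeta k n (Suc m). real (x j) / Pi_fact k x)"
    by (rule sum.swap)
  also have "\<dots> = (\<Sum>j=1..k. \<Sum>x | x \<in> Omega_zeta k n (Suc m) \<and> x j > 0. real (x j) / Pi_fact k x)"
    by (intro sum.cong refl sum.mono_neutral_right) (auto simp: finite_Omega)
  also have "\<dots> = (\<Sum>j | j \<in> {1..k} \<and> j \<le> n.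
      \<Sum>x | x \<in> Omega_zeta k n (Suc m) \<and> x j > 0. real (x j) / Pi_fact k x)"
  \<comment> \<open>A positive entry at \<open>j\<close> alone contributes at least \<open>j\<close>
    to the weight \<open>n\<close>, so for \<open>j > n\<close> the inner index set is
    empty.\<close>
  proof (intro sum.mono_neutral_right ballI sum.neutral)
    fix j x
    assume j: "j \<in> {1..k} - {j. j \<in> {1..k} \<and> j \<le> n}"
      and x: "x \<in> {x. x \<in> Omega_zeta k n (Suc m) \<and> 0 < x j}"
    have "x j > 0" using x by simp
    then have "j \<le> j * x j" by simp
    also have "\<dots> \<le> (\<Sum>i=1..k. i * x i)"
      using j by (intro member_le_sum) auto
    also have "\<dots> = n" using x by (simp add: Omega_def)
    finally show "real (x j) / Pi_fact k x = 0" using j by (simp del: atLeastAtMost_iff)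
  qed auto
  also have "\<dots> = (\<Sum>j | j \<in> {1..k} \<and> j \<le> n. \<Sum>y\<in>Omega_zeta k (n - j) m. 1 / Pi_fact k y)"
  proof (rule sum.cong[OF refl])
    fix j assume "j \<in> {j. j \<in> {1..k} \<and> j \<le> n}"
    then have j: "j \<in> {1..k}" "j \<le> n" by auto
    \<comment> \<open>By \<open>Pi_fact_increment\<close>, the new entry \<open>Suc (y j)\<close>
      over the new factorial product is again \<open>1 / Pi_fact k y\<close>; the summand thus takes
      the form that the bijection transports.\<close>
    have "(\<Sum>y\<in>Omega_zeta k (n - j) m. 1 / Pi_fact k y) =
      (\<Sum>y\<in>Omega_zeta k (n - j) m. real ((y(j := Suc (y j))) j) / Pi_fact k (y(j := Suc (y j))))"
      by (intro sum.cong refl) (simp add: Pi_fact_increment[OF j(1)])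
    also have "\<dots> = (\<Sum>x | x \<in> Omega_zeta k n (Suc m) \<and> x j > 0. real (x j) / Pi_fact k x)"
      by (rule sum.reindex_bij_betw[OF bij_betw_Omega_zeta_increment[OF j],
            where g = "\<lambda>x. real (x j) / Pi_fact k x"])
    finally show "(\<Sum>x | x \<in> Omega_zeta k n (Suc m) \<and> x j > 0. real (x j) / Pi_fact k x) =
      (\<Sum>y\<in>Omega_zeta k (n - j) m. 1 / Pi_fact k y)" by simp
  qed
  finally show ?thesis .
qed

lemma Omega_zeta_0: "Omega_zeta k n 0 = (if n = 0 then {\<lambda>j\<in>{1..k}. 0} else {})"
  by (auto simp: Omega_def zeta_def PiE_iff extensional_def restrict_def fun_eq_iff)

lemma zeta_le_Omega:
  assumes "x \<in> Omega k n"
  shows "zeta k x \<le> n"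
proof -
  have "zeta k x \<le> (\<Sum>j=1..k. j * x j)"
    unfolding zeta_def by (intro sum_mono) auto
  then show ?thesis using assms by (simp add: Omega_def)
qed

section \<open>Sums of i.i.d. uniform variables\<close>

context prob_space
begin

text \<open>Splitting by the value of the last variable gives a recursion in \<open>m\<close>. Up to
  normalization it is the recursion of \<open>sum_inverse_Pi_fact_Suc\<close>, so induction takes
  the place of counting arrangements by multinomial coefficients.\<close>

lemma prob_sum_iid_uniform:
  assumes indep: "indep_vars (\<lambda>_. count_space UNIV) X {1..}"
    and dist: "\<And>i. i \<ge> 1 \<Longrightarrow> distr M (count_space UNIV) (X i) = measure_pmf (pmf_of_set {1..k})"
    and "k \<ge> 1"
  shows "prob {\<omega> \<in> space M. (\<Sum>i=1..m. X i \<omega>) = n} =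
    fact m / real k ^ m * (\<Sum>x\<in>Omega_zeta k n m. 1 / Pi_fact k x)"
proof (induction m arbitrary: n)
  case 0
  show ?case
    by (simp add: Omega_zeta_0 prob_space Pi_fact_def)
next
  case (Suc m)
  have rv: "X i \<in> measurable M (count_space UNIV)" if "i \<ge> 1" for i
    using indep that by (auto simp: indep_vars_def)
  have [measurable]: "X i \<in> measurable M (count_space UNIV)" if "i \<in> {1..m}" for i
    using rv that by simp
  have [measurable]: "X (Suc m) \<in> measurable M (count_space UNIV)"
    using rv by simp
  \<comment> \<open>The cast to the reals prepares for \<open>indep_vars_sum\<close>, which
    separates the last variable from the sum of the earlier ones.\<close>
  have "indep_vars (\<lambda>_. borel) (\<lambda>i \<omega>. real (X i \<omega>)) {1..}"
    by (rule indep_vars_compose2[OF indep]) simp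
  then have "indep_vars (\<lambda>_. borel) (\<lambda>i \<omega>. real (X i \<omega>)) (insert (Suc m) {1..m})"
    by (rule indep_vars_subset) auto
  then have indep': "indep_var borel (\<lambda>\<omega>. real (X (Suc m) \<omega>)) borel (\<lambda>\<omega>. \<Sum>i=1..m. real (X i \<omega>))"
    by (intro indep_vars_sum) auto
  \<comment> \<open>For \<open>j > n\<close> the difference \<open>n - j\<close> truncates; the
    identity still holds, but it is summed below only over \<open>j \<le> n\<close>, where it
    describes the event that the total is \<open>n\<close>.\<close>
  have joint: "prob {\<omega> \<in> space M. X (Suc m) \<omega> = j \<and> (\<Sum>i=1..m. X i \<omega>) = n - j} =
      (if j \<in> {1..k} then 1 / real k else 0) *
      prob {\<omega> \<in> space M. (\<Sum>i=1..m. X i \<omega>) = n - j}" for j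
  proof -
    have "prob {\<omega> \<in> space M. X (Suc m) \<omega> = j} = prob (X (Suc m) -` {j} \<inter> space M)"
      by (rule arg_cong[where f = prob]) auto
    also have "\<dots> = measure (distr M (count_space UNIV) (X (Suc m))) {j}"
      by (subst measure_distr) auto
    also have "\<dots> = (if j \<in> {1..k} then 1 / real k else 0)"
      using \<open>k \<ge> 1\<close> by (simp add: dist measure_pmf_single)
    finally have X: "prob {\<omega> \<in> space M. X (Suc m) \<omega> = j} = (if j \<in> {1..k} then 1 / real k else 0)" .
    have "prob {\<omega> \<in> space M. X (Suc m) \<omega> = j \<and> (\<Sum>i=1..m. X i \<omega>) = n - j} =
      prob ((\<lambda>\<omega>. (real (X (Suc m) \<omega>), \<Sum>i=1..m. real (X i \<omega>))) -` ({real j} \<times> {real (n - j)}) \<inter> space M)"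
      by (rule arg_cong[where f = prob]) (auto simp flip: of_nat_sum)
    also have "\<dots> = prob ((\<lambda>\<omega>. real (X (Suc m) \<omega>)) -` {real j} \<inter> space M) *
      prob ((\<lambda>\<omega>. \<Sum>i=1..m. real (X i \<omega>)) -` {real (n - j)} \<inter> space M)"
      by (rule indep_varD[OF indep']) auto
    also have "(\<lambda>\<omega>. real (X (Suc m) \<omega>)) -` {real j} \<inter> space M = {\<omega> \<in> space M. X (Suc m) \<omega> = j}"
      by auto
    also have "(\<lambda>\<omega>. \<Sum>i=1..m. real (X i \<omega>)) -` {real (n - j)} \<inter> space M =
      {\<omega> \<in> space M. (\<Sum>i=1..m. X i \<omega>) = n - j}"
      by (auto simp flip: of_nat_sum)
    finally show ?thesis by (simp only: X)
  qed
  have "{\<omega> \<in> space M. (\<Sum>i=1..Suc m. X i \<omega>) = n} =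
      (\<Union>j\<in>{..n}. {\<omega> \<in> space M. X (Suc m) \<omega> = j \<and> (\<Sum>i=1..m. X i \<omega>) = n - j})"
    by auto
  also have "prob \<dots> =
      (\<Sum>j\<in>{..n}. prob {\<omega> \<in> space M. X (Suc m) \<omega> = j \<and> (\<Sum>i=1..m. X i \<omega>) = n - j})"
    by (intro finite_measure_finite_Union) (auto simp: disjoint_family_on_def)
  also have "\<dots> = (\<Sum>j\<in>{..n}. if j \<in> {1..k} then
      fact m / real k ^ Suc m * (\<Sum>x\<in>Omega_zeta k (n - j) m. 1 / Pi_fact k x) else 0)"
    unfolding joint Suc.IH by (intro sum.cong refl) simp
  also have "\<dots> = (\<Sum>j | j \<in> {1..k} \<and> j \<le> n.
      fact m / real k ^ Suc m * (\<Sum>x\<in>Omega_zeta k (n - j) m. 1 / Pi_fact k x))"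
    by (subst sum.inter_restrict[symmetric]) (auto intro!: sum.cong)
  \<comment> \<open>The combinatorial recursion supplies the factor \<open>Suc m\<close> that turns
    \<open>fact m\<close> into \<open>fact (Suc m)\<close>.\<close>
  also have "\<dots> = fact (Suc m) / real k ^ Suc m * (\<Sum>x\<in>Omega_zeta k n (Suc m). 1 / Pi_fact k x)"
    unfolding sum_distrib_left[symmetric] sum_inverse_Pi_fact_Suc[symmetric] by simp
  finally show ?case .
qed

section \<open>Independence on generated events\<close>

lemma independent_processes_prob:
  assumes "independent_processes M S I X T J Y"
    and "A \<in> generated_events M S I X" and "B \<in> generated_events M T J Y"
  shows "prob (A \<inter> B) = prob A * prob B"
  using assms indep_setD by (auto simp: independent_processes_def)

lemma generated_events_single:
  assumes "i \<in> I" and "A \<in> sets S"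
  shows "{\<omega> \<in> space M. X i \<omega> \<in> A} \<in> generated_events M S I X"
proof -
  have "{\<omega> \<in> space M. X i \<omega> \<in> A} = X i -` A \<inter> space M" by auto
  then show ?thesis
    unfolding generated_events_def using assms by (intro sigma_sets.Basic) auto
qed

text \<open>An event about a sum involves several members of the family and need not be a generator.
  Taking the generated sets as the sigma-algebra of a measure space \<open>F\<close> makes each
  \<open>X i\<close> measurable there, hence the sum too.\<close>

lemma generated_events_sum:
  fixes X :: "'i \<Rightarrow> 'a \<Rightarrow> nat"
  assumes "K \<subseteq> I"
  shows "{\<omega> \<in> space M. (\<Sum>i\<in>K. X i \<omega>) = n} \<in> generated_events M (count_space UNIV) I X"
proof -
  define F where "F = sigma (space M) (\<Union>i\<in>I. {X i -` A \<inter> space M | A. A \<in> sets (count_space UNIV)})"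
  have gen: "sets F = generated_events M (count_space UNIV) I X" and sp: "space F = space M"
    unfolding F_def generated_events_def by (subst sets_measure_of; auto) (simp add: space_measure_of_conv)
  have [measurable]: "X i \<in> measurable F (count_space UNIV)" if "i \<in> K" for i
  proof (rule measurableI)
    fix A
    show "X i -` A \<inter> space F \<in> sets F"
      using generated_events_single[of i I A "count_space UNIV" X] that assms
      by (simp add: gen sp vimage_def Int_def conj_commute subset_iff)
  qed simp
  have "{\<omega> \<in> space F. (\<Sum>i\<in>K. X i \<omega>) = n} \<in> sets F"
    by measurable
  then show ?thesis by (simp add: gen sp)
qed

section \<open>The process of order \<open>k\<close> at a fixed time\<close>

lemma prob_poisson_process_of_order:
  assumes Nk: "poisson_process_of_order M k lam Nk" and k: "k \<ge> 1" and lam: "lam > 0" and s: "s \<ge> 0"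
  shows "prob {\<omega> \<in> space M. Nk s \<omega> = n} =
    (\<Sum>x\<in>Omega k n. lam ^ zeta k x / Pi_fact k x * (exp (- (real k * lam * s)) * s ^ zeta k x))"
    and "Nk s \<in> measurable M (count_space UNIV)"
proof -
  from Nk obtain N X where N: "poisson_process M (real k * lam) N"
    and X0: "\<forall>\<omega>\<in>space M. X 0 \<omega> = 0"
    and indep: "indep_vars (\<lambda>_. count_space UNIV) X {1..}"
    and dist: "\<forall>i\<ge>1. distr M (count_space UNIV) (X i) = measure_pmf (pmf_of_set {1..k})"
    and ind: "independent_processes M (count_space UNIV) {1..} X (count_space UNIV) {0..} N"
    and NkX: "\<forall>t\<ge>0. \<forall>\<omega>\<in>space M. Nk t \<omega> = (\<Sum>i=0..N t \<omega>. X i \<omega>)"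
    unfolding poisson_process_of_order_def by blast
  have rvX: "X i \<in> measurable M (count_space UNIV)" if "i \<ge> 1" for i
    using indep that by (auto simp: indep_vars_def)
  have [measurable]: "X i \<in> measurable M (count_space UNIV)" if "i \<in> {1..m}" for i m
    using rvX that by simp
  have Ns[measurable]: "N s \<in> measurable M (count_space UNIV)"
    using N s by (auto simp: poisson_process_def)
  have Nks: "Nk s \<omega> = (\<Sum>i=1..N s \<omega>. X i \<omega>)" if "\<omega> \<in> space M" for \<omega>
    using NkX X0 s that by (simp add: sum.atLeast_Suc_atMost)
  have "(\<lambda>\<omega>. \<Sum>i=1..N s \<omega>. X i \<omega>) \<in> measurable M (count_space UNIV)"
    by (rule measurable_compose_countable[where g = "N s" and f = "\<lambda>m \<omega>. \<Sum>i=1..m. X i \<omega>", OF _ Ns]) measurable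
  then show "Nk s \<in> measurable M (count_space UNIV)"
    by (subst measurable_cong[OF Nks])
  have poisson: "prob {\<omega> \<in> space M. N s \<omega> = m} =
    exp (- (real k * lam * s)) * (real k * lam * s) ^ m / fact m" for m
  \<comment> \<open>The law of increments is given only for intervals of positive length. At
    \<open>s = 0\<close> the count is zero by definition, and the formula agrees because
    \<open>0 ^ 0 = 1\<close>.\<close>
  proof (cases "s = 0")
    case True
    then have "{\<omega> \<in> space M. N s \<omega> = m} = (if m = 0 then space M else {})"
      using N by (auto simp: poisson_process_def)
    then show ?thesis using True by (simp add: prob_space)
  next
    case False
    have "{\<omega> \<in> space M. N s \<omega> = m} = (\<lambda>\<omega>. N s \<omega> - N 0 \<omega>) -` {m} \<inter> space M"
      using N by (auto simp: poisson_process_def)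
    also have "prob \<dots> = measure (distr M (count_space UNIV) (\<lambda>\<omega>. N s \<omega> - N 0 \<omega>)) {m}"
      using N by (subst measure_distr) (auto simp: poisson_process_def)
    also have "\<dots> = pmf (poisson_pmf (real k * lam * s)) m"
      using N s False by (simp add: poisson_process_def pmf.rep_eq)
    finally show ?thesis using lam k s False by simp
  qed
  \<comment> \<open>The event that the process equals \<open>n\<close> is partitioned by the number
    \<open>m\<close> of Poisson events. With \<open>m\<close> fixed, the first set depends on the
    jump sizes only and the second on the Poisson process only.\<close>
  define E where "E m = {\<omega> \<in> space M. (\<Sum>i=1..m. X i \<omega>) = n} \<inter> {\<omega> \<in> space M. N s \<omega> = m}" for m
  have prob_E: "prob (E m) = (\<Sum>x\<in>Omega_zeta k n m.
      lam ^ zeta k x / Pi_fact k x * (exp (- (real k * lam * s)) * s ^ zeta k x))" for m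
  proof -
    have "{\<omega> \<in> space M. (\<Sum>i=1..m. X i \<omega>) = n} \<in> generated_events M (count_space UNIV) {1..} X"
      by (rule generated_events_sum) auto
    moreover have "{\<omega> \<in> space M. N s \<omega> = m} \<in> generated_events M (count_space UNIV) {0..} N"
      using generated_events_single[of s "{0..}" "{m}" "count_space UNIV" N] s by simp
    ultimately have "prob (E m) = prob {\<omega> \<in> space M. (\<Sum>i=1..m. X i \<omega>) = n} * prob {\<omega> \<in> space M. N s \<omega> = m}"
      unfolding E_def by (rule independent_processes_prob[OF ind])
    \<comment> \<open>Here \<open>fact m\<close> and \<open>real k ^ m\<close> cancel between the
      Poisson weight and the law of the sum.\<close>
    also have "\<dots> = lam ^ m * (exp (- (real k * lam * s)) * s ^ m) * (\<Sum>x\<in>Omega_zeta k n m. 1 / Pi_fact k x)"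
      using k by (subst prob_sum_iid_uniform[OF indep _ k])
        (auto simp: dist poisson power_mult_distrib)
    finally show ?thesis by (simp add: sum_distrib_left)
  qed
  have "{\<omega> \<in> space M. N s \<omega> = m} \<in> events" for m
    using measurable_sets[OF Ns, of "{m}"] by (simp add: vimage_def Int_def conj_commute)
  then have "range E \<subseteq> events"
    unfolding E_def by (intro image_subsetI sets.Int) measurable
  moreover have "disjoint_family E"
    by (auto simp: disjoint_family_on_def E_def)
  ultimately have "(\<lambda>m. prob (E m)) sums prob (\<Union>m. E m)"
    by (rule finite_measure_UNION)
  moreover have "(\<lambda>m. prob (E m)) sums (\<Sum>m\<le>n. prob (E m))"
  proof (rule sums_finite)
    \<comment> \<open>Jumps have size at least 1, so more than \<open>n\<close> of them cannot add
      up to \<open>n\<close>; the series over \<open>m\<close> is a finite sum.\<close>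
    fix m assume "m \<notin> {..n}"
    then have "Omega_zeta k n m = {}" by (auto dest: zeta_le_Omega)
    then show "prob (E m) = 0" by (simp only: prob_E sum.empty)
  qed simp
  ultimately have "prob (\<Union>m. E m) = (\<Sum>m\<le>n. prob (E m))"
    by (rule sums_unique2)
  moreover have "(\<Union>m. E m) = {\<omega> \<in> space M. Nk s \<omega> = n}"
    by (auto simp: E_def Nks)
  ultimately have "prob {\<omega> \<in> space M. Nk s \<omega> = n} = (\<Sum>m\<le>n. prob (E m))"
    by simp
  also have "\<dots> = (\<Sum>x\<in>Omega k n. lam ^ zeta k x / Pi_fact k x * (exp (- (real k * lam * s)) * s ^ zeta k x))"
    unfolding prob_E by (rule sum.group) (auto simp: finite_Omega dest: zeta_le_Omega)
  finally show "prob {\<omega> \<in> space M. Nk s \<omega> = n} =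
    (\<Sum>x\<in>Omega k n. lam ^ zeta k x / Pi_fact k x * (exp (- (real k * lam * s)) * s ^ zeta k x))" .
qed

section \<open>Evaluation at an independent random time\<close>

lemma poisson_process_of_order_right_continuous:
  assumes "poisson_process_of_order M k lam Nk" and "s \<ge> 0" and "\<omega> \<in> space M"
  shows "eventually (\<lambda>u. Nk u \<omega> = Nk s \<omega>) (at_right s)"
proof -
  from assms obtain N X where N: "poisson_process M (real k * lam) N"
    and NkX: "\<And>t. t \<ge> 0 \<Longrightarrow> Nk t \<omega> = (\<Sum>i=0..N t \<omega>. X i \<omega>)"
    unfolding poisson_process_of_order_def by blast
  have "((\<lambda>u. N u \<omega>) \<longlongrightarrow> N s \<omega>) (at_right s)"
    using N assms by (auto simp: poisson_process_def continuous_within)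
  \<comment> \<open>Convergence in the discrete space \<open>nat\<close> is eventual equality. For
    fixed \<open>\<omega>\<close>, the process of order \<open>k\<close> depends on the time only
    through \<open>N\<close>, so it inherits this.\<close>
  then have "eventually (\<lambda>u. N u \<omega> = N s \<omega>) (at_right s)"
    by (simp add: tendsto_discrete)
  moreover have "eventually (\<lambda>u. u > s) (at_right s)"
    by (rule eventually_at_right_less)
  ultimately show ?thesis
    by eventually_elim (use assms(2) in \<open>simp add: NkX\<close>)
qed

text \<open>On each atom \<open>J \<omega> = j\<close> the random index is frozen and the
  probability factors; summing over the countably many atoms turns the products into an expectation.
  Independence is asked of one index at a time, not of the whole family.\<close>

lemma prob_countable_conditioning:
  fixes J :: "'a \<Rightarrow> nat" and Y :: "nat \<Rightarrow> 'a \<Rightarrow> nat"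
  assumes [measurable]: "J \<in> measurable M (count_space UNIV)"
    and [measurable]: "\<And>j. Y j \<in> measurable M (count_space UNIV)"
    and indep: "\<And>j. prob ({\<omega> \<in> space M. Y j \<omega> = n} \<inter> {\<omega> \<in> space M. J \<omega> = j}) =
       prob {\<omega> \<in> space M. Y j \<omega> = n} * prob {\<omega> \<in> space M. J \<omega> = j}"
  shows "prob {\<omega> \<in> space M. Y (J \<omega>) \<omega> = n} =
    expectation (\<lambda>\<omega>. prob {\<omega>' \<in> space M. Y (J \<omega>) \<omega>' = n})"
proof -
  let ?g = "\<lambda>j. prob {\<omega> \<in> space M. Y j \<omega> = n}"
  let ?E = "\<lambda>j. {\<omega> \<in> space M. Y j \<omega> = n} \<inter> {\<omega> \<in> space M. J \<omega> = j}"
  have "{\<omega> \<in> space M. Y (J \<omega>) \<omega> = n} = (\<Union>j. ?E j)"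
    by auto
  also have "emeasure M \<dots> = (\<Sum>j. emeasure M (?E j))"
    by (rule suminf_emeasure[symmetric]) (auto simp: disjoint_family_on_def)
  also have "\<dots> = (\<Sum>j. \<integral>\<^sup>+\<omega>. ennreal (?g j) * indicator {\<omega> \<in> space M. J \<omega> = j} \<omega> \<partial>M)"
    by (simp add: emeasure_eq_measure indep ennreal_mult nn_integral_cmult_indicator)
  also have "\<dots> = (\<integral>\<^sup>+\<omega>. (\<Sum>j. ennreal (?g j) * indicator {\<omega> \<in> space M. J \<omega> = j} \<omega>) \<partial>M)"
    by (rule nn_integral_suminf[symmetric]) simp
  also have "\<dots> = (\<integral>\<^sup>+\<omega>. ennreal (?g (J \<omega>)) \<partial>M)"
  proof (rule nn_integral_cong)
    fix \<omega> assume "\<omega> \<in> space M"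
    then have "(\<Sum>j. ennreal (?g j) * indicator {\<omega> \<in> space M. J \<omega> = j} \<omega>) =
      (\<Sum>j\<in>{J \<omega>}. ennreal (?g j) * indicator {\<omega> \<in> space M. J \<omega> = j} \<omega>)"
      by (intro suminf_finite) auto
    then show "(\<Sum>j. ennreal (?g j) * indicator {\<omega> \<in> space M. J \<omega> = j} \<omega>) = ennreal (?g (J \<omega>))"
      using \<open>\<omega> \<in> space M\<close> by simp
  qed
  also have "\<dots> = ennreal (expectation (\<lambda>\<omega>. ?g (J \<omega>)))"
    by (intro nn_integral_eq_integral integrable_const_bound[where B = 1]) auto
  finally show ?thesis
    by (simp add: emeasure_eq_measure)
qed

text \<open>
  The random time is approximated strictly from above by times in a countable set, where
  independence applies atom by atom; right continuity of the paths removes the approximation.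
\<close>

lemma prob_at_independent_time:
  fixes Y :: "real \<Rightarrow> 'a \<Rightarrow> nat" and T :: "'a \<Rightarrow> real"
  assumes T[measurable]: "T \<in> borel_measurable M"
    and nonneg: "\<And>\<omega>. \<omega> \<in> space M \<Longrightarrow> T \<omega> \<ge> 0"
    and Y: "\<And>s. s \<ge> 0 \<Longrightarrow> Y s \<in> measurable M (count_space UNIV)"
    and right_cont: "\<And>s \<omega>. s \<ge> 0 \<Longrightarrow> \<omega> \<in> space M \<Longrightarrow> eventually (\<lambda>u. Y u \<omega> = Y s \<omega>) (at_right s)"
    and indep: "\<And>s A. s \<ge> 0 \<Longrightarrow> A \<in> sets borel \<Longrightarrow>
      prob ({\<omega> \<in> space M. Y s \<omega> = n} \<inter> {\<omega> \<in> space M. T \<omega> \<in> A}) =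
      prob {\<omega> \<in> space M. Y s \<omega> = n} * prob {\<omega> \<in> space M. T \<omega> \<in> A}"
    and g: "\<And>s. s \<ge> 0 \<Longrightarrow> prob {\<omega> \<in> space M. Y s \<omega> = n} = g s"
    and cont: "continuous_on UNIV g"
  shows "prob {\<omega> \<in> space M. Y (T \<omega>) \<omega> = n} = expectation (\<lambda>\<omega>. g (T \<omega>))"
proof -
  \<comment> \<open>The time \<open>s i (J i \<omega>)\<close> is a point of the grid of mesh
    \<open>1 / Suc i\<close>. Taking \<open>Suc\<close> of the floor makes it strictly larger than
    \<open>T \<omega>\<close>, even when \<open>T \<omega>\<close> is itself a grid point, as the
    filter \<open>at_right\<close> demands.\<close>
  define J where "J i \<omega> = Suc (nat \<lfloor>T \<omega> * real (Suc i)\<rfloor>)" for i \<omega>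
  define s where "s i j = real j / real (Suc i)" for i j :: nat
  have J[measurable]: "J i \<in> measurable M (count_space UNIV)" for i
    unfolding J_def by measurable
  have s[simp]: "s i j \<ge> 0" for i j by (simp add: s_def)
  have [measurable]: "Y (s i j) \<in> measurable M (count_space UNIV)" for i j
    by (simp add: Y)
  have [measurable]: "g \<in> borel_measurable borel"
    using cont by (rule borel_measurable_continuous_onI)
  have bounds: "T \<omega> < s i (J i \<omega>)" "s i (J i \<omega>) \<le> T \<omega> + 1 / real (Suc i)" if "\<omega> \<in> space M" for i \<omega>
  proof -
    have "T \<omega> * real (Suc i) \<ge> 0" using nonneg[OF that] by simp
    then have "T \<omega> * real (Suc i) < real (J i \<omega>)" "real (J i \<omega>) \<le> T \<omega> * real (Suc i) + 1"
      unfolding J_def by linarith+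
    then show "T \<omega> < s i (J i \<omega>)" "s i (J i \<omega>) \<le> T \<omega> + 1 / real (Suc i)"
      unfolding s_def by (simp_all add: field_simps del: of_nat_Suc)
  qed
  have lim: "(\<lambda>i. s i (J i \<omega>)) \<longlonglongrightarrow> T \<omega>" if "\<omega> \<in> space M" for \<omega>
  proof (rule tendsto_sandwich)
    show "\<forall>\<^sub>F i in sequentially. T \<omega> \<le> s i (J i \<omega>)"
      using bounds(1)[OF that] by (intro always_eventually allI less_imp_le)
    show "\<forall>\<^sub>F i in sequentially. s i (J i \<omega>) \<le> T \<omega> + 1 / real (Suc i)"
      using bounds(2)[OF that] by simp
    have "(\<lambda>i. T \<omega> + 1 / real (Suc i)) \<longlonglongrightarrow> T \<omega> + 0"
      by (intro tendsto_intros lim_1_over_n[THEN LIMSEQ_Suc])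
    then show "(\<lambda>i. T \<omega> + 1 / real (Suc i)) \<longlonglongrightarrow> T \<omega>" by simp
  qed simp
  have lim_Y: "(\<lambda>i. real (Y (s i (J i \<omega>)) \<omega>)) \<longlonglongrightarrow> real (Y (T \<omega>) \<omega>)"
    and lim_ind: "(\<lambda>i. indicator {n} (Y (s i (J i \<omega>)) \<omega>) :: real) \<longlonglongrightarrow> indicator {n} (Y (T \<omega>) \<omega>)"
    if "\<omega> \<in> space M" for \<omega>
  proof -
    have "filterlim (\<lambda>i. s i (J i \<omega>)) (at_right (T \<omega>)) sequentially"
      using lim[OF that] bounds(1)[OF that] by (auto simp: filterlim_at intro!: always_eventually less_imp_neq[symmetric])
    with right_cont[OF nonneg[OF that] that]
    have ev: "\<forall>\<^sub>F i in sequentially. Y (s i (J i \<omega>)) \<omega> = Y (T \<omega>) \<omega>"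
      by (rule eventually_compose_filterlim)
    show "(\<lambda>i. real (Y (s i (J i \<omega>)) \<omega>)) \<longlonglongrightarrow> real (Y (T \<omega>) \<omega>)"
      "(\<lambda>i. indicator {n} (Y (s i (J i \<omega>)) \<omega>) :: real) \<longlonglongrightarrow> indicator {n} (Y (T \<omega>) \<omega>)"
      by (rule tendsto_eventually, use ev in eventually_elim, simp)+
  qed
  have meas_i[measurable]: "(\<lambda>\<omega>. Y (s i (J i \<omega>)) \<omega>) \<in> measurable M (count_space UNIV)" for i
    by (rule measurable_compose_countable[where g = "J i" and f = "\<lambda>j. Y (s i j)"]) measurable
  \<comment> \<open>Joint measurability of \<open>Y\<close> in time and \<open>\<omega>\<close> is
    not assumed. Measurability at the random time comes from the pointwise limit, taken in the reals
    and brought back to \<open>nat\<close> by the floor.\<close>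
  have "(\<lambda>\<omega>. real (Y (T \<omega>) \<omega>)) \<in> borel_measurable M"
    by (rule borel_measurable_LIMSEQ_real[OF lim_Y]) measurable
  then have "(\<lambda>\<omega>. nat \<lfloor>real (Y (T \<omega>) \<omega>)\<rfloor>) \<in> measurable M (count_space UNIV)"
    by measurable
  then have [measurable]: "(\<lambda>\<omega>. Y (T \<omega>) \<omega>) \<in> measurable M (count_space UNIV)"
    by simp
  have prob_ind: "prob {\<omega> \<in> space M. Z \<omega> = n} = expectation (\<lambda>\<omega>. indicator {n} (Z \<omega>))"
    if [measurable]: "Z \<in> measurable M (count_space UNIV)" for Z :: "'a \<Rightarrow> nat"
  proof -
    have "expectation (\<lambda>\<omega>. indicator {n} (Z \<omega>) :: real) = expectation (indicator {\<omega> \<in> space M. Z \<omega> = n})"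
      by (intro Bochner_Integration.integral_cong) (auto simp: indicator_def)
    then show ?thesis by simp
  qed
  have approx: "expectation (\<lambda>\<omega>. indicator {n} (Y (s i (J i \<omega>)) \<omega>)) = expectation (\<lambda>\<omega>. g (s i (J i \<omega>)))" for i
  proof -
    have "prob {\<omega> \<in> space M. Y (s i (J i \<omega>)) \<omega> = n} =
      expectation (\<lambda>\<omega>. prob {\<omega>' \<in> space M. Y (s i (J i \<omega>)) \<omega>' = n})"
    proof (rule prob_countable_conditioning[where Y = "\<lambda>j. Y (s i j)"])
      fix j
      \<comment> \<open>The event \<open>J i \<omega> = j\<close> says that
        \<open>T \<omega>\<close> lies in a Borel set, so the independence hypothesis covers
        it.\<close>
      have "{x::real. Suc (nat \<lfloor>x * real (Suc i)\<rfloor>) = j} \<in> sets borel"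
        by measurable
      from indep[OF s this]
      show "prob ({\<omega> \<in> space M. Y (s i j) \<omega> = n} \<inter> {\<omega> \<in> space M. J i \<omega> = j}) =
        prob {\<omega> \<in> space M. Y (s i j) \<omega> = n} * prob {\<omega> \<in> space M. J i \<omega> = j}"
        by (simp add: J_def)
    qed measurable
    then show ?thesis by (simp add: g flip: prob_ind)
  qed
  \<comment> \<open>At non-negative times \<open>g\<close> is a probability, so the constant 1
    dominates.\<close>
  have g01: "norm (g u) \<le> 1" if "u \<ge> 0" for u
    using that by (simp flip: g)
  have "(\<lambda>i. expectation (\<lambda>\<omega>. g (s i (J i \<omega>)))) \<longlonglongrightarrow> expectation (\<lambda>\<omega>. g (T \<omega>))"
  proof (rule integral_dominated_convergence[where w = "\<lambda>_. 1"])
    show "AE \<omega> in M. (\<lambda>i. g (s i (J i \<omega>))) \<longlonglongrightarrow> g (T \<omega>)"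
      using cont lim by (intro AE_I2) (auto intro: continuous_on_tendsto_compose)
    show "(\<lambda>\<omega>. g (s i (J i \<omega>))) \<in> borel_measurable M" for i
      unfolding s_def by measurable
    show "AE \<omega> in M. norm (g (s i (J i \<omega>))) \<le> 1" for i
      by (intro AE_I2 g01 s)
  qed auto
  moreover have "(\<lambda>i. expectation (\<lambda>\<omega>. indicator {n} (Y (s i (J i \<omega>)) \<omega>) :: real)) \<longlonglongrightarrow>
      expectation (\<lambda>\<omega>. indicator {n} (Y (T \<omega>) \<omega>))"
  proof (rule integral_dominated_convergence[where w = "\<lambda>_. 1"])
    show "AE \<omega> in M. (\<lambda>i. indicator {n} (Y (s i (J i \<omega>)) \<omega>) :: real) \<longlonglongrightarrow> indicator {n} (Y (T \<omega>) \<omega>)"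
      using lim_ind by (intro AE_I2)
  qed (auto simp: indicator_def)
  ultimately have "expectation (\<lambda>\<omega>. indicator {n} (Y (T \<omega>) \<omega>)) = expectation (\<lambda>\<omega>. g (T \<omega>))"
    unfolding approx by (rule LIMSEQ_unique[symmetric])
  then show ?thesis by (simp add: prob_ind)
qed

end

section \<open>Insertion of the subordinator\<close>

theorem theorem3p1:
  fixes M :: "'w measure"
    and k :: nat and lam :: real and f :: "real \<Rightarrow> real"
    and D :: "real \<Rightarrow> 'w \<Rightarrow> real"
    and Nk Q :: "real \<Rightarrow> 'w \<Rightarrow> nat"
  assumes "prob_space M"
    and "k \<ge> 1" and "lam > 0"
    and "levy_subordinator M f D"
    and "\<forall>t\<ge>0. \<forall>\<rho>>0. integrable M (\<lambda>\<omega>. D t \<omega> powr \<rho>)"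
    and "poisson_process_of_order M k lam Nk"
    and "independent_processes M (count_space UNIV) {0..} Nk borel {0..} D"
    and "\<forall>t\<ge>0. \<forall>\<omega>\<in>space M. Q t \<omega> = Nk (D t \<omega>) \<omega>"
  shows "\<forall>t\<ge>0. \<forall>n::nat.
    measure M {\<omega> \<in> space M. Q t \<omega> = n} =
    (\<Sum>x\<in>Omega k n. lam ^ zeta k x / Pi_fact k x *
       (LINT \<omega>|M. exp (- (real k * lam * D t \<omega>)) * D t \<omega> ^ zeta k x))"
proof (intro allI impI)
  fix t :: real and n :: nat
  assume t: "t \<ge> 0"
  interpret prob_space M by fact
  have T[measurable]: "D t \<in> borel_measurable M" and nonneg: "\<And>\<omega>. \<omega> \<in> space M \<Longrightarrow> D t \<omega> \<ge> 0"
    using assms(4) t by (auto simp: levy_subordinator_def levy_process_def)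
  let ?h = "\<lambda>x s. exp (- (real k * lam * s)) * s ^ zeta k x"
  have int: "integrable M (\<lambda>\<omega>. ?h x (D t \<omega>))" for x
  \<comment> \<open>The moment hypothesis covers positive exponents only, and
    \<open>0 powr 0 = 0\<close> differs from \<open>0 ^ 0 = 1\<close>. For exponent zero the
    exponential is bounded by 1; otherwise the moment of order \<open>zeta k x\<close>
    dominates.\<close>
  proof (cases "zeta k x = 0")
    case True
    then show ?thesis
      using nonneg \<open>lam > 0\<close> by (intro integrable_const_bound[where B = 1]) auto
  next
    case False
    have "integrable M (\<lambda>\<omega>. D t \<omega> powr real (zeta k x))"
      using assms(5) t False by auto
    then have "integrable M (\<lambda>\<omega>. D t \<omega> ^ zeta k x)"
      using nonneg False by (simp add: powr_realpow' cong: Bochner_Integration.integrable_cong)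
    then show ?thesis
      by (rule Bochner_Integration.integrable_bound)
        (use nonneg \<open>lam > 0\<close> in \<open>auto simp: abs_mult intro!: mult_left_le_one_le\<close>)
  qed
  have "{\<omega> \<in> space M. Q t \<omega> = n} = {\<omega> \<in> space M. Nk (D t \<omega>) \<omega> = n}"
    using assms(8) t by auto
  also have "prob \<dots> = expectation (\<lambda>\<omega>. \<Sum>x\<in>Omega k n. lam ^ zeta k x / Pi_fact k x * ?h x (D t \<omega>))"
  proof (rule prob_at_independent_time[OF T nonneg,
        where g = "\<lambda>s. \<Sum>x\<in>Omega k n. lam ^ zeta k x / Pi_fact k x * ?h x s"])
    show "Nk s \<in> measurable M (count_space UNIV)"
      and "prob {\<omega> \<in> space M. Nk s \<omega> = n} = (\<Sum>x\<in>Omega k n. lam ^ zeta k x / Pi_fact k x * ?h x s)"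
      if "s \<ge> 0" for s
      using prob_poisson_process_of_order[OF assms(6,2,3) that] by auto
    show "\<forall>\<^sub>F u in at_right s. Nk u \<omega> = Nk s \<omega>" if "s \<ge> 0" "\<omega> \<in> space M" for s \<omega>
      using poisson_process_of_order_right_continuous[OF assms(6) that] .
    show "prob ({\<omega> \<in> space M. Nk s \<omega> = n} \<inter> {\<omega> \<in> space M. D t \<omega> \<in> A}) =
        prob {\<omega> \<in> space M. Nk s \<omega> = n} * prob {\<omega> \<in> space M. D t \<omega> \<in> A}"
      if "s \<ge> 0" "A \<in> sets borel" for s A
    proof (rule independent_processes_prob[OF assms(7)])
      show "{\<omega> \<in> space M. Nk s \<omega> = n} \<in> generated_events M (count_space UNIV) {0..} Nk"
        using generated_events_single[of s "{0..}" "{n}" "count_space UNIV" Nk] that by simp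
      show "{\<omega> \<in> space M. D t \<omega> \<in> A} \<in> generated_events M borel {0..} D"
        using t that by (intro generated_events_single) auto
    qed
    show "continuous_on UNIV (\<lambda>s. \<Sum>x\<in>Omega k n. lam ^ zeta k x / Pi_fact k x * ?h x s)"
      by (intro continuous_intros)
  qed
  also have "\<dots> = (\<Sum>x\<in>Omega k n. lam ^ zeta k x / Pi_fact k x * expectation (\<lambda>\<omega>. ?h x (D t \<omega>)))"
    using int by (simp add: Bochner_Integration.integral_sum)
  finally show "measure M {\<omega> \<in> space M. Q t \<omega> = n} =
    (\<Sum>x\<in>Omega k n. lam ^ zeta k x / Pi_fact k x *
       (LINT \<omega>|M. exp (- (real k * lam * D t \<omega>)) * D t \<omega> ^ zeta k x))" .
qed

end
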